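(* Let $\mathcal{F}r$ be a finite set of frame axioms and let $LS_g[\mathcal{F}r]$ be the calculus $LS$ extended with the structural rule synthesised from each axiom of $\mathcal{F}r$. If a formula $F$ is not provable in $LS_g[\mathcal{F}r]$ (i.e. for a label $w\neq\epsilon$ the sequent $\emptyset;\emptyset\vdash w:F$ has no derivation), then $F$ is not valid in the Kripke relational models whose frames satisfy every axiom in $\mathcal{F}r$.
   Context: Formulae: built from propositional variables $p$ (countable set $Var$) and constants $\top,\bot,\top^*$ using $\land,\to,*,-\!*$. Labels: countably infinite set $\mathcal{L}$ with distinguished label $\epsilon$. Relational atoms: $(a,b\triangleright c)$, $a=b$, $a\neq b$ for labels $a,b,c$. Labelled formula: $a:A$. A sequent $\mathcal{G};\Gamma\vdash\Delta$ has a finite set $\mathcal{G}$ of relational atoms and finite sets $\Gamma,\Delta$ of labelled formulae (commas denote union). $E(\mathcal{G})\vdash a=b$ holds iff $(a,b)$ is in the smallest equivalence relation on $\mathcal{L}$ containing all $(c,d)$ with $c=d\in\mathcal{G}$. The calculus $LS$ (no cut rule) has rules (from premises infer conclusion): zero-premise rules $(id)$ $\mathcal{G};\Gamma,a:p\vdash b:p,\Delta$ if $E(\mathcal{G})\vdash a=b$ ($p$ a propositional variable); $(\bot L)$ $\mathcal{G};\Gamma,a:\bot\vdash\Delta$; $(\top R)$ $\mathcal{G};\Gamma\vdash a:\top,\Delta$; $(\top^*R)$ $\mathcal{G};\Gamma\vdash a:\top^*,\Delta$ if $E(\mathcal{G})\vdash a=\epsilon$; $(NEq)$ $\mathcal{G};\Gamma\vdash\Delta$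 if $a\neq b\in\mathcal{G}$ and $E(\mathcal{G})\vdash a=b$. $(\top^*L)$: from $\mathcal{G}\cup\{a=\epsilon\};\Gamma\vdash\Delta$ infer $\mathcal{G};\Gamma,a:\top^*\vdash\Delta$. $(\land L)$: from $\mathcal{G};\Gamma,a:A,a:B\vdash\Delta$ infer $\mathcal{G};\Gamma,a:A\land B\vdash\Delta$. $(\land R)$: from $\mathcal{G};\Gamma\vdash a:A,\Delta$ and $\mathcal{G};\Gamma\vdash a:B,\Delta$ infer $\mathcal{G};\Gamma\vdash a:A\land B,\Delta$. $(\to L)$: from $\mathcal{G};\Gamma\vdash a:A,\Delta$ and $\mathcal{G};\Gamma,a:B\vdash\Delta$ infer $\mathcal{G};\Gamma,a:A\to B\vdash\Delta$. $(\to R)$: from $\mathcal{G};\Gamma,a:A\vdash a:B,\Delta$ infer $\mathcal{G};\Gamma\vdash a:A\to B,\Delta$. $( *L)$: from $\mathcal{G}\cup\{(x,y\triangleright z)\};\Gamma,x:A,y:B\vdash\Delta$ infer $\mathcal{G};\Gamma,z:A*B\vdash\Delta$, where $x,y$ are distinct labels, not $\epsilon$, not occurring in the conclusion. $(-\!*R)$: from $\mathcal{G}\cup\{(x,z\triangleright y)\};\Gamma,x:A\vdash y:B,\Delta$ infer $\mathcal{G};\Gamma\vdash z:A-\!*B,\Delta$, same freshness condition. $( *R)$: if $(x,y\triangleright z)\in\mathcal{G}$ and $E(\mathcal{G})\vdash z=w$, from $\mathcal{G};\Gamma\vdash x:A,w:A*B,\Delta$ and $\mathcal{G};\Gamma\vdash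 y:B,w:A*B,\Delta$ infer $\mathcal{G};\Gamma\vdash w:A*B,\Delta$. $(-\!*L)$: if $(x,w\triangleright y)\in\mathcal{G}$ and $E(\mathcal{G})\vdash z=w$, from $\mathcal{G};\Gamma,z:A-\!*B\vdash x:A,\Delta$ and $\mathcal{G};\Gamma,z:A-\!*B,y:B\vdash\Delta$ infer $\mathcal{G};\Gamma,z:A-\!*B\vdash\Delta$. $(EM)$: from $\mathcal{G}\cup\{a=b\};\Gamma\vdash\Delta$ and $\mathcal{G}\cup\{a\neq b\};\Gamma\vdash\Delta$ infer $\mathcal{G};\Gamma\vdash\Delta$. A frame axiom is a first-order sentence over constant $\epsilon$, ternary relation $\triangleright$ and equality of the form $\forall x_1..x_m.(s_1=t_1\&\cdots\& s_p=t_p\& S_1\&\cdots\& S_k\Rightarrow\exists y_1..y_n.(T_1\&\cdots\& T_l))$ where $s_i,t_i\in\{x_1,..,x_m,\epsilon\}$; each $S_i$ is a ternary atom $(x_u,x_v\triangleright x_w)$ or a disequality between members of $\{x_1,..,x_m,\epsilon\}$; $\epsilon$ does not occur in ternary $S_i$ and each variable occurs at most once altogether in $S_1..S_k$; each $T_i$ is a ternary atom, equality or disequality over $x$'s, $y$'s and $\epsilon$. Its synthesised structural rule: for any substitution $\theta$ of labels for $x_1..x_m$ (fixing $\epsilon$) with $S_i\theta\in\mathcal{G}$ for all $i$ and $E(\mathcal{G})\vdash s_i\theta=t_i\theta$ for all $i$, and distinct labels $b_1..b_n\neq\epsilon$ not occurring in the conclusion, with $\sigma=[b_1/y_1,..,b_n/y_n]$: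 from $\mathcal{G}\cup\{T_1\theta\sigma,..,T_l\theta\sigma\};\Gamma\vdash\Delta$ infer $\mathcal{G};\Gamma\vdash\Delta$. A derivation is a finite tree of rule instances whose leaves are zero-premise rules. Semantics: a Kripke relational frame is $(H,R,\epsilon_H)$ with $R\subseteq H^3$, $\epsilon_H\in H$; it satisfies a frame axiom if the sentence is true with $\triangleright:=R$, $\epsilon:=\epsilon_H$, $=$ identity. A model adds $v:Var\to\mathcal{P}(H)$; $h\Vdash p$ iff $h\in v(p)$; $\top$ always, $\bot$ never; $h\Vdash\top^*$ iff $h=\epsilon_H$; $\land,\to$ classical; $h\Vdash A*B$ iff $\exists h_1,h_2$ with $R(h_1,h_2,h)$, $h_1\Vdash A$, $h_2\Vdash B$; $h\Vdash A-\!*B$ iff for all $h_1,h_2$ with $R(h_1,h,h_2)$ and $h_1\Vdash A$, $h_2\Vdash B$. $F$ is valid in a class of models iff it is forced at every world of every model in the class. *)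

theory Defs
  imports "HOL-Library.FSet" "HOL-Library.Countable"
begin

section \<open>Formulae, labels and sequents\<close>

datatype 'v fm =
    Var 'v
  | Top
  | Bot
  | TopStar
  | And "'v fm" "'v fm"
  | Imp "'v fm" "'v fm"
  | Star "'v fm" "'v fm"
  | Wand "'v fm" "'v fm"

datatype label = Eps | Lab nat

text \<open>
  Relational atoms over an arbitrary type of terms: they are used over labels in sequents, over
  first-order terms in frame axioms, and over worlds when axioms are evaluated. The atom
  \<^term>\<open>Tri a b c\<close> stands for $(a, b \triangleright c)$.
\<close>

datatype 'a atom = Tri 'a 'a 'a | Eq 'a 'a | Neq 'a 'a

primrec atom_terms :: "'a atom \<Rightarrow> 'a list" where
  "atom_terms (Tri a b c) = [a, b, c]"
| "atom_terms (Eq a b) = [a, b]"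
| "atom_terms (Neq a b) = [a, b]"

type_synonym 'v lfm = "label \<times> 'v fm"

definition eq_entails :: "label atom fset \<Rightarrow> label \<Rightarrow> label \<Rightarrow> bool" where
  "eq_entails G = equivclp (\<lambda>c d. Eq c d |\<in>| G)"

definition seq_labels :: "label atom fset \<Rightarrow> 'v lfm fset \<Rightarrow> 'v lfm fset \<Rightarrow> label set" where
  "seq_labels G \<Gamma> \<Delta> = (\<Union>\<alpha>\<in>fset G. set_atom \<alpha>) \<union> fst ` fset \<Gamma> \<union> fst ` fset \<Delta>"

section \<open>Frame axioms\<close>

text \<open>
  \<^term>\<open>AX i\<close> for \<open>i < m\<close> are the universally quantified variables of an axiom, \<^term>\<open>AY j\<close> for
  \<open>j < n\<close> the existentially quantified ones.
\<close>

datatype axterm = AEps | AX nat | AY nat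

record frame_axiom =
  ax_m :: nat
  ax_n :: nat
  ax_eqs :: "(axterm \<times> axterm) list"
  ax_ants :: "axterm atom list"
  ax_cons :: "axterm atom list"

definition univ_terms :: "nat \<Rightarrow> axterm set" where
  "univ_terms m = insert AEps (AX ` {..<m})"

definition ex_terms :: "nat \<Rightarrow> axterm set" where
  "ex_terms n = AY ` {..<n}"

definition admissible_ant :: "nat \<Rightarrow> axterm atom \<Rightarrow> bool" where
  "admissible_ant m S \<longleftrightarrow>
     (case S of
        Tri s t u \<Rightarrow> {s, t, u} \<subseteq> univ_terms m - {AEps}
      | Neq s t \<Rightarrow> {s, t} \<subseteq> univ_terms m
      | Eq s t \<Rightarrow> False)"

definition is_frame_axiom :: "frame_axiom \<Rightarrow> bool" where
  "is_frame_axiom ax \<longleftrightarrow>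
     (\<forall>(s, t)\<in>set (ax_eqs ax). {s, t} \<subseteq> univ_terms (ax_m ax)) \<and>
     (\<forall>S\<in>set (ax_ants ax). admissible_ant (ax_m ax) S) \<and>
     distinct (filter (\<lambda>t. t \<noteq> AEps) (concat (map atom_terms (ax_ants ax)))) \<and>
     (\<forall>T\<in>set (ax_cons ax). set_atom T \<subseteq> univ_terms (ax_m ax) \<union> ex_terms (ax_n ax))"

text \<open>
  Instantiation of the terms of an axiom, both by labels (the substitution \<open>\<theta>\<close> followed by
  \<open>\<sigma>\<close>) and by worlds (an assignment to the quantified variables).
\<close>

primrec inst :: "'a \<Rightarrow> (nat \<Rightarrow> 'a) \<Rightarrow> (nat \<Rightarrow> 'a) \<Rightarrow> axterm \<Rightarrow> 'a" where
  "inst e x y AEps = e"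
| "inst e x y (AX i) = x i"
| "inst e x y (AY j) = y j"

section \<open>The calculus\<close>

text \<open>
  Side formulae are arbitrary finite sets, so they may contain the principal formula of a rule.
  In rule \<open>Frame\<close> the premises about \<^const>\<open>ax_ants\<close> and \<^const>\<open>ax_eqs\<close> do not depend on \<open>b\<close>,
  since no \<^const>\<open>AY\<close> occurs there in a frame axiom. Its freshness condition concerns the labels
  of the conclusion only; \<open>b\<close> is not required to avoid the values of \<open>\<theta>\<close>.
\<close>

inductive derivable ::
  "frame_axiom set \<Rightarrow> label atom fset \<Rightarrow> 'v lfm fset \<Rightarrow> 'v lfm fset \<Rightarrow> bool"
  for Fr :: "frame_axiom set"
where
  Id: "eq_entails G a b \<Longrightarrow> derivable Fr G (finsert (a, Var p) \<Gamma>) (finsert (b, Var p) \<Delta>)"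
| BotL: "derivable Fr G (finsert (a, Bot) \<Gamma>) \<Delta>"
| TopR: "derivable Fr G \<Gamma> (finsert (a, Top) \<Delta>)"
| TopStarR: "eq_entails G a Eps \<Longrightarrow> derivable Fr G \<Gamma> (finsert (a, TopStar) \<Delta>)"
| NEq: "\<lbrakk> Neq a b |\<in>| G; eq_entails G a b \<rbrakk> \<Longrightarrow> derivable Fr G \<Gamma> \<Delta>"
| TopStarL:
    "derivable Fr (finsert (Eq a Eps) G) \<Gamma> \<Delta> \<Longrightarrow> derivable Fr G (finsert (a, TopStar) \<Gamma>) \<Delta>"
| AndL:
    "derivable Fr G (finsert (a, A) (finsert (a, B) \<Gamma>)) \<Delta> \<Longrightarrow>
     derivable Fr G (finsert (a, And A B) \<Gamma>) \<Delta>"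
| AndR:
    "\<lbrakk> derivable Fr G \<Gamma> (finsert (a, A) \<Delta>); derivable Fr G \<Gamma> (finsert (a, B) \<Delta>) \<rbrakk> \<Longrightarrow>
     derivable Fr G \<Gamma> (finsert (a, And A B) \<Delta>)"
| ImpL:
    "\<lbrakk> derivable Fr G \<Gamma> (finsert (a, A) \<Delta>); derivable Fr G (finsert (a, B) \<Gamma>) \<Delta> \<rbrakk> \<Longrightarrow>
     derivable Fr G (finsert (a, Imp A B) \<Gamma>) \<Delta>"
| ImpR:
    "derivable Fr G (finsert (a, A) \<Gamma>) (finsert (a, B) \<Delta>) \<Longrightarrow>
     derivable Fr G \<Gamma> (finsert (a, Imp A B) \<Delta>)"
| StarL:
    "\<lbrakk> x \<noteq> y; x \<noteq> Eps; y \<noteq> Eps;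
       x \<notin> seq_labels G (finsert (z, Star A B) \<Gamma>) \<Delta>;
       y \<notin> seq_labels G (finsert (z, Star A B) \<Gamma>) \<Delta>;
       derivable Fr (finsert (Tri x y z) G) (finsert (x, A) (finsert (y, B) \<Gamma>)) \<Delta> \<rbrakk> \<Longrightarrow>
     derivable Fr G (finsert (z, Star A B) \<Gamma>) \<Delta>"
| WandR:
    "\<lbrakk> x \<noteq> y; x \<noteq> Eps; y \<noteq> Eps;
       x \<notin> seq_labels G \<Gamma> (finsert (z, Wand A B) \<Delta>);
       y \<notin> seq_labels G \<Gamma> (finsert (z, Wand A B) \<Delta>);
       derivable Fr (finsert (Tri x z y) G) (finsert (x, A) \<Gamma>) (finsert (y, B) \<Delta>) \<rbrakk> \<Longrightarrow>
     derivable Fr G \<Gamma> (finsert (z, Wand A B) \<Delta>)"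
| StarR:
    "\<lbrakk> Tri x y z |\<in>| G; eq_entails G z w;
       derivable Fr G \<Gamma> (finsert (x, A) (finsert (w, Star A B) \<Delta>));
       derivable Fr G \<Gamma> (finsert (y, B) (finsert (w, Star A B) \<Delta>)) \<rbrakk> \<Longrightarrow>
     derivable Fr G \<Gamma> (finsert (w, Star A B) \<Delta>)"
| WandL:
    "\<lbrakk> Tri x w y |\<in>| G; eq_entails G z w;
       derivable Fr G (finsert (z, Wand A B) \<Gamma>) (finsert (x, A) \<Delta>);
       derivable Fr G (finsert (z, Wand A B) (finsert (y, B) \<Gamma>)) \<Delta> \<rbrakk> \<Longrightarrow>
     derivable Fr G (finsert (z, Wand A B) \<Gamma>) \<Delta>"
| EM:
    "\<lbrakk> derivable Fr (finsert (Eq a b) G) \<Gamma> \<Delta>; derivable Fr (finsert (Neq a b) G) \<Gamma> \<Delta> \<rbrakk> \<Longrightarrow>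
     derivable Fr G \<Gamma> \<Delta>"
| Frame:
    "\<lbrakk> ax \<in> Fr;
       \<forall>S\<in>set (ax_ants ax). map_atom (inst Eps \<theta> b) S |\<in>| G;
       \<forall>(s, t)\<in>set (ax_eqs ax). eq_entails G (inst Eps \<theta> b s) (inst Eps \<theta> b t);
       inj_on b {..<ax_n ax};
       \<forall>j<ax_n ax. b j \<noteq> Eps \<and> b j \<notin> seq_labels G \<Gamma> \<Delta>;
       derivable Fr (G |\<union>| fset_of_list (map (map_atom (inst Eps \<theta> b)) (ax_cons ax))) \<Gamma> \<Delta> \<rbrakk> \<Longrightarrow>
     derivable Fr G \<Gamma> \<Delta>"

section \<open>Kripke relational semantics\<close>

record 'h frame =
  worlds :: "'h set"
  rel :: "('h \<times> 'h \<times> 'h) set"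
  unit :: 'h

record ('h, 'v) model = "'h frame" +
  val :: "'v \<Rightarrow> 'h set"

definition is_frame :: "('h, 'z) frame_scheme \<Rightarrow> bool" where
  "is_frame M \<longleftrightarrow> rel M \<subseteq> worlds M \<times> worlds M \<times> worlds M \<and> unit M \<in> worlds M"

definition is_model :: "('h, 'v) model \<Rightarrow> bool" where
  "is_model M \<longleftrightarrow> is_frame M \<and> (\<forall>p. val M p \<subseteq> worlds M)"

primrec atom_holds :: "('h, 'z) frame_scheme \<Rightarrow> 'h atom \<Rightarrow> bool" where
  "atom_holds M (Tri a b c) \<longleftrightarrow> (a, b, c) \<in> rel M"
| "atom_holds M (Eq a b) \<longleftrightarrow> a = b"
| "atom_holds M (Neq a b) \<longleftrightarrow> a \<noteq> b"

text \<open>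
  In the antecedent the second assignment given to \<^const>\<open>inst\<close> is a dummy: no \<^const>\<open>AY\<close> occurs
  there in a frame axiom.
\<close>

definition satisfies :: "('h, 'z) frame_scheme \<Rightarrow> frame_axiom \<Rightarrow> bool" where
  "satisfies M ax \<longleftrightarrow>
     (\<forall>x. (\<forall>i<ax_m ax. x i \<in> worlds M) \<longrightarrow>
        (\<forall>(s, t)\<in>set (ax_eqs ax). inst (unit M) x x s = inst (unit M) x x t) \<longrightarrow>
        (\<forall>S\<in>set (ax_ants ax). atom_holds M (map_atom (inst (unit M) x x) S)) \<longrightarrow>
        (\<exists>y. (\<forall>j<ax_n ax. y j \<in> worlds M) \<and>
           (\<forall>T\<in>set (ax_cons ax). atom_holds M (map_atom (inst (unit M) x y) T))))"

primrec forces :: "('h, 'v) model \<Rightarrow> 'h \<Rightarrow> 'v fm \<Rightarrow> bool" where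
  "forces M h (Var p) \<longleftrightarrow> h \<in> val M p"
| "forces M h Top \<longleftrightarrow> True"
| "forces M h Bot \<longleftrightarrow> False"
| "forces M h TopStar \<longleftrightarrow> h = unit M"
| "forces M h (And A B) \<longleftrightarrow> forces M h A \<and> forces M h B"
| "forces M h (Imp A B) \<longleftrightarrow> (forces M h A \<longrightarrow> forces M h B)"
| "forces M h (Star A B) \<longleftrightarrow>
     (\<exists>h1\<in>worlds M. \<exists>h2\<in>worlds M. (h1, h2, h) \<in> rel M \<and> forces M h1 A \<and> forces M h2 B)"
| "forces M h (Wand A B) \<longleftrightarrow>
     (\<forall>h1\<in>worlds M. \<forall>h2\<in>worlds M. (h1, h, h2) \<in> rel M \<and> forces M h1 A \<longrightarrow> forces M h2 B)"

text \<open>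
  Worlds form an arbitrary subset of \<^typ>\<open>'h\<close>. Since HOL cannot quantify over types inside a formula,
  the type of worlds is a parameter; any infinite \<^typ>\<open>'h\<close> has room for all countable frames.
\<close>

definition models_of :: "frame_axiom set \<Rightarrow> ('h, 'v) model set" where
  "models_of Fr = {M. is_model M \<and> (\<forall>ax\<in>Fr. satisfies M ax)}"

definition valid_in :: "('h, 'v) model set \<Rightarrow> 'v fm \<Rightarrow> bool" where
  "valid_in C F \<longleftrightarrow> (\<forall>M\<in>C. \<forall>h\<in>worlds M. forces M h F)"

end

theory Submission
  imports Defs "HOL-Library.Product_Order"
begin

text \<open>
  An underivable sequent is extended step by step, always staying underivable, along a fair
  enumeration of all backward rule instances. The limit is a Hintikka set of atoms and labelled
  formulae, and labels modulo its equations form a countermodel, which embeds into any infinite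
  type. A frame axiom holds there because its variables occur at most once in the antecedent atoms:
  representatives of the worlds can then be chosen independently for every ternary atom, so that
  the atoms literally belong to the limit, while \<open>EM\<close> provides the disequalities. Hence the
  structural rule has been applied to them.
\<close>

section \<open>Countability of the syntax\<close>

instance fm :: (countable) countable by countable_datatype
instance label :: countable by countable_datatype
instance atom :: (countable) countable by countable_datatype
instance axterm :: countable by countable_datatype

instance frame_axiom_ext :: (countable) countable
  by (rule countable_classI[of "\<lambda>r. to_nat (ax_m r, ax_n r, ax_eqs r, ax_ants r, ax_cons r,
        frame_axiom.more r)"]) (simp add: frame_axiom.equality)

section \<open>Backward rule instances\<close>

text \<open>The same closure as \<open>eq_entails\<close>, taken over an arbitrary set because the
  limit of the chain may contain infinitely many atoms.\<close>

definition label_eq :: "label atom set \<Rightarrow> label \<Rightarrow> label \<Rightarrow> bool" where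
  "label_eq G = equivclp (\<lambda>c d. Eq c d \<in> G)"

lemma eq_entails_iff_label_eq: "eq_entails G = label_eq (fset G)"
  by (simp add: eq_entails_def label_eq_def)

text \<open>A task names one rule to be applied backwards. For most connectives the principal
  formula suffices; \<open>StarR\<close> and \<open>WandL\<close> must be repeated for every
  matching ternary atom, so their tasks carry labels. \<open>FrameT\<close> stores the substitution
  as a list, not a function, which keeps the type of tasks countable.\<close>

datatype 'v task =
    LeftT label "'v fm"
  | RightT label "'v fm"
  | StarT label label label "'v fm" "'v fm"
  | WandT label label label "'v fm" "'v fm"
  | EMT label label
  | FrameT frame_axiom "label list"

instance task :: (countable) countable by countable_datatype

text \<open>The presence of the principal formula together with the side conditions. Only finitely
  many facts are involved, so activity at the limit already shows along the chain. In
  \<open>FrameT\<close> the second assignment is a dummy.\<close>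

primrec active ::
  "frame_axiom set \<Rightarrow> 'v task \<Rightarrow> label atom set \<Rightarrow> 'v lfm set \<Rightarrow> 'v lfm set \<Rightarrow> bool"
where
  "active Fr (LeftT a A) G \<Gamma> \<Delta> \<longleftrightarrow> (a, A) \<in> \<Gamma>"
| "active Fr (RightT a A) G \<Gamma> \<Delta> \<longleftrightarrow> (a, A) \<in> \<Delta>"
| "active Fr (StarT x y w A B) G \<Gamma> \<Delta> \<longleftrightarrow>
     (w, Star A B) \<in> \<Delta> \<and> (\<exists>z. Tri x y z \<in> G \<and> label_eq G z w)"
| "active Fr (WandT x z y A B) G \<Gamma> \<Delta> \<longleftrightarrow>
     (z, Wand A B) \<in> \<Gamma> \<and> (\<exists>w. Tri x w y \<in> G \<and> label_eq G z w)"
| "active Fr (EMT a b) G \<Gamma> \<Delta> \<longleftrightarrow> True"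
| "active Fr (FrameT ax xs) G \<Gamma> \<Delta> \<longleftrightarrow>
     ax \<in> Fr \<and>
     (\<forall>S\<in>set (ax_ants ax). map_atom (inst Eps ((!) xs) ((!) xs)) S \<in> G) \<and>
     (\<forall>(s, t)\<in>set (ax_eqs ax).
        label_eq G (inst Eps ((!) xs) ((!) xs) s) (inst Eps ((!) xs) ((!) xs) t))"

text \<open>\<open>False\<close> for \<open>Bot\<close>, since \<open>BotL\<close> closes such a
  sequent; \<open>True\<close> for \<open>Wand\<close>, whose obligations are separate tasks
  \<open>WandT\<close>.\<close>

primrec left_reduced ::
  "label \<Rightarrow> 'v fm \<Rightarrow> label atom set \<Rightarrow> 'v lfm set \<Rightarrow> 'v lfm set \<Rightarrow> bool"
where
  "left_reduced a (Var p) G \<Gamma> \<Delta> \<longleftrightarrow> True"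
| "left_reduced a Top G \<Gamma> \<Delta> \<longleftrightarrow> True"
| "left_reduced a Bot G \<Gamma> \<Delta> \<longleftrightarrow> False"
| "left_reduced a TopStar G \<Gamma> \<Delta> \<longleftrightarrow> Eq a Eps \<in> G"
| "left_reduced a (And A B) G \<Gamma> \<Delta> \<longleftrightarrow> (a, A) \<in> \<Gamma> \<and> (a, B) \<in> \<Gamma>"
| "left_reduced a (Imp A B) G \<Gamma> \<Delta> \<longleftrightarrow> (a, A) \<in> \<Delta> \<or> (a, B) \<in> \<Gamma>"
| "left_reduced a (Star A B) G \<Gamma> \<Delta> \<longleftrightarrow> (\<exists>x y. Tri x y a \<in> G \<and> (x, A) \<in> \<Gamma> \<and> (y, B) \<in> \<Gamma>)"
| "left_reduced a (Wand A B) G \<Gamma> \<Delta> \<longleftrightarrow> True"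

text \<open>\<open>False\<close> for \<open>Top\<close>, which closes the sequent. For
  \<open>Var\<close> and \<open>TopStar\<close> the closing rules depend on equations that may
  arrive later, so these cases are settled at the limit; \<open>Star\<close> is left to
  \<open>StarT\<close>.\<close>

primrec right_reduced ::
  "label \<Rightarrow> 'v fm \<Rightarrow> label atom set \<Rightarrow> 'v lfm set \<Rightarrow> 'v lfm set \<Rightarrow> bool"
where
  "right_reduced a (Var p) G \<Gamma> \<Delta> \<longleftrightarrow> True"
| "right_reduced a Top G \<Gamma> \<Delta> \<longleftrightarrow> False"
| "right_reduced a Bot G \<Gamma> \<Delta> \<longleftrightarrow> True"
| "right_reduced a TopStar G \<Gamma> \<Delta> \<longleftrightarrow> True"
| "right_reduced a (And A B) G \<Gamma> \<Delta> \<longleftrightarrow> (a, A) \<in> \<Delta> \<or> (a, B) \<in> \<Delta>"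
| "right_reduced a (Imp A B) G \<Gamma> \<Delta> \<longleftrightarrow> (a, A) \<in> \<Gamma> \<and> (a, B) \<in> \<Delta>"
| "right_reduced a (Star A B) G \<Gamma> \<Delta> \<longleftrightarrow> True"
| "right_reduced a (Wand A B) G \<Gamma> \<Delta> \<longleftrightarrow> (\<exists>x y. Tri x a y \<in> G \<and> (x, A) \<in> \<Gamma> \<and> (y, B) \<in> \<Delta>)"

text \<open>The freshness of \<open>b\<close> is forgotten in the \<open>FrameT\<close> clause: it
  is a condition for applying the rule, while the truth of the axiom needs just some witnesses. All
  clauses are monotone, so a fulfilled task stays fulfilled.\<close>

primrec fulfilled ::
  "'v task \<Rightarrow> label atom set \<Rightarrow> 'v lfm set \<Rightarrow> 'v lfm set \<Rightarrow> bool"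
where
  "fulfilled (LeftT a A) G \<Gamma> \<Delta> \<longleftrightarrow> left_reduced a A G \<Gamma> \<Delta>"
| "fulfilled (RightT a A) G \<Gamma> \<Delta> \<longleftrightarrow> right_reduced a A G \<Gamma> \<Delta>"
| "fulfilled (StarT x y w A B) G \<Gamma> \<Delta> \<longleftrightarrow> (x, A) \<in> \<Delta> \<or> (y, B) \<in> \<Delta>"
| "fulfilled (WandT x z y A B) G \<Gamma> \<Delta> \<longleftrightarrow> (x, A) \<in> \<Delta> \<or> (y, B) \<in> \<Gamma>"
| "fulfilled (EMT a b) G \<Gamma> \<Delta> \<longleftrightarrow> Eq a b \<in> G \<or> Neq a b \<in> G"
| "fulfilled (FrameT ax xs) G \<Gamma> \<Delta> \<longleftrightarrow>
     (\<exists>b. \<forall>T\<in>set (ax_cons ax). map_atom (inst Eps ((!) xs) b) T \<in> G)"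

lemma fulfilled_mono:
  assumes "fulfilled t G \<Gamma> \<Delta>" "G \<subseteq> G'" "\<Gamma> \<subseteq> \<Gamma>'" "\<Delta> \<subseteq> \<Delta>'"
  shows "fulfilled t G' \<Gamma>' \<Delta>'"
proof (cases t)
  case (LeftT a A)
  with assms show ?thesis by (cases A) auto
next
  case (RightT a A)
  with assms show ?thesis by (cases A) (auto, blast+)
qed (use assms in \<open>auto, blast\<close>)

section \<open>Instantiation of axiom terms and supply of fresh labels\<close>

text \<open>No \<open>AY\<close> lies in \<open>univ_terms m\<close>, so the second assignment may
  be exchanged freely. This passes between the dummy in \<open>active\<close> and the fresh labels
  in rule \<open>Frame\<close>.\<close>

lemma map_atom_inst_cong:
  assumes "set_atom T \<subseteq> univ_terms m" "\<And>i. i < m \<Longrightarrow> x i = x' i"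
  shows "map_atom (inst e x y) T = map_atom (inst e x' y') T"
  by (rule atom.map_cong0) (use assms in \<open>auto simp: univ_terms_def\<close>)

lemma admissible_ant_terms: "admissible_ant m S \<Longrightarrow> set_atom S \<subseteq> univ_terms m"
  by (cases S) (auto simp: admissible_ant_def)

lemma inst_cong:
  assumes "s \<in> univ_terms m" "\<And>i. i < m \<Longrightarrow> x i = x' i"
  shows "inst e x y s = inst e x' y' s"
  using assms by (auto simp: univ_terms_def)

lemma infinite_labels: "infinite (UNIV :: label set)"
proof -
  have "inj Lab" by (simp add: inj_def)
  then show ?thesis
    by (metis finite_subset infinite_UNIV_nat finite_imageD subset_UNIV)
qed

text \<open>One infinite injective supply serves both the two labels of \<open>StarL\<close> and
  \<open>WandR\<close> and the \<open>ax_n\<close> labels of \<open>Frame\<close>.\<close>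

lemma fresh_labels:
  obtains b :: "nat \<Rightarrow> label"
  where "inj b" "\<And>j. b j \<noteq> Eps" "\<And>j. b j \<notin> seq_labels G \<Gamma> \<Delta>"
proof -
  have "finite (set_atom \<alpha>)" for \<alpha> :: "label atom" by (cases \<alpha>) auto
  then have "finite (insert Eps (seq_labels G \<Gamma> \<Delta>))"
    by (auto simp: seq_labels_def)
  then have "infinite (- insert Eps (seq_labels G \<Gamma> \<Delta>))"
    using infinite_labels by (metis Compl_eq_Diff_UNIV Diff_infinite_finite)
  from infinite_countable_subset[OF this] show ?thesis
    using that by blast
qed

section \<open>Extending underivable sequents\<close>

text \<open>Contraposition of each rule: an underivable conclusion has an underivable premise, and
  that premise contains what the task asks for.\<close>

lemma underivable_fulfil:
  assumes ax: "\<forall>ax\<in>Fr. is_frame_axiom ax"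
    and nd: "\<not> derivable Fr G \<Gamma> \<Delta>"
    and act: "active Fr t (fset G) (fset \<Gamma>) (fset \<Delta>)"
  shows "\<exists>G' \<Gamma>' \<Delta>'. G |\<subseteq>| G' \<and> \<Gamma> |\<subseteq>| \<Gamma>' \<and> \<Delta> |\<subseteq>| \<Delta>' \<and> \<not> derivable Fr G' \<Gamma>' \<Delta>' \<and>
    fulfilled t (fset G') (fset \<Gamma>') (fset \<Delta>')"
proof (cases t)
  case (LeftT a A)
  \<comment> \<open>Sequents are sets and a side context may contain the principal formula, so the
    rule can be applied without losing it. Hence the premise extends the conclusion.\<close>
  with act have m: "finsert (a, A) \<Gamma> = \<Gamma>" by (simp add: finsert_absorb)
  obtain b :: "nat \<Rightarrow> label"
    where b: "inj b" "\<And>j. b j \<noteq> Eps" "\<And>j. b j \<notin> seq_labels G \<Gamma> \<Delta>"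
    using fresh_labels by blast
  from b(1) have b01: "b 0 \<noteq> b 1" by (simp add: inj_eq)
  show ?thesis
  proof (cases A)
    case Bot
    with derivable.BotL[of Fr G a \<Gamma> \<Delta>] m nd show ?thesis by simp
  next
    case TopStar
    with derivable.TopStarL[of Fr a G \<Gamma> \<Delta>] m nd
    have "\<not> derivable Fr (finsert (Eq a Eps) G) \<Gamma> \<Delta>" by auto
    then show ?thesis using LeftT TopStar
      by (intro exI[of _ "finsert (Eq a Eps) G"] exI[of _ \<Gamma>] exI[of _ \<Delta>]) auto
  next
    case (And B C)
    with derivable.AndL[of Fr G a B C \<Gamma> \<Delta>] m nd
    have "\<not> derivable Fr G (finsert (a, B) (finsert (a, C) \<Gamma>)) \<Delta>" by auto
    then show ?thesis using LeftT And
      by (intro exI[of _ G] exI[of _ "finsert (a, B) (finsert (a, C) \<Gamma>)"] exI[of _ \<Delta>]) auto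
  next
    case (Imp B C)
    with derivable.ImpL[of Fr G \<Gamma> a B \<Delta> C] m nd
    consider "\<not> derivable Fr G \<Gamma> (finsert (a, B) \<Delta>)" | "\<not> derivable Fr G (finsert (a, C) \<Gamma>) \<Delta>"
      by auto
    then show ?thesis
    proof cases
      case 1
      then show ?thesis using LeftT Imp
        by (intro exI[of _ G] exI[of _ \<Gamma>] exI[of _ "finsert (a, B) \<Delta>"]) auto
    next
      case 2
      then show ?thesis using LeftT Imp
        by (intro exI[of _ G] exI[of _ "finsert (a, C) \<Gamma>"] exI[of _ \<Delta>]) auto
    qed
  next
    case (Star B C)
    with m have m': "finsert (a, Star B C) \<Gamma> = \<Gamma>" by simp
    \<comment> \<open>Rewriting with \<open>m'\<close> turns the freshness condition of the rule
      into freshness for the given sequent.\<close>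
    from derivable.StarL[of "b 0" "b 1" G a B C \<Gamma> \<Delta> Fr, unfolded m',
        OF b01 b(2) b(2) b(3) b(3)] nd
    have "\<not> derivable Fr (finsert (Tri (b 0) (b 1) a) G)
      (finsert (b 0, B) (finsert (b 1, C) \<Gamma>)) \<Delta>" by blast
    then show ?thesis using LeftT Star
      by (intro exI[of _ "finsert (Tri (b 0) (b 1) a) G"]
          exI[of _ "finsert (b 0, B) (finsert (b 1, C) \<Gamma>)"] exI[of _ \<Delta>]) auto
  qed (use nd LeftT in auto)
next
  case (RightT a A)
  with act have m: "finsert (a, A) \<Delta> = \<Delta>" by (simp add: finsert_absorb)
  obtain b :: "nat \<Rightarrow> label"
    where b: "inj b" "\<And>j. b j \<noteq> Eps" "\<And>j. b j \<notin> seq_labels G \<Gamma> \<Delta>"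
    using fresh_labels by blast
  from b(1) have b01: "b 0 \<noteq> b 1" by (simp add: inj_eq)
  show ?thesis
  proof (cases A)
    case Top
    with derivable.TopR[of Fr G \<Gamma> a \<Delta>] m nd show ?thesis by simp
  next
    case (And B C)
    with derivable.AndR[of Fr G \<Gamma> a B \<Delta> C] m nd
    consider "\<not> derivable Fr G \<Gamma> (finsert (a, B) \<Delta>)" | "\<not> derivable Fr G \<Gamma> (finsert (a, C) \<Delta>)"
      by auto
    then show ?thesis
    proof cases
      case 1
      then show ?thesis using RightT And
        by (intro exI[of _ G] exI[of _ \<Gamma>] exI[of _ "finsert (a, B) \<Delta>"]) auto
    next
      case 2
      then show ?thesis using RightT And
        by (intro exI[of _ G] exI[of _ \<Gamma>] exI[of _ "finsert (a, C) \<Delta>"]) auto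
    qed
  next
    case (Imp B C)
    with derivable.ImpR[of Fr G a B \<Gamma> C \<Delta>] m nd
    have "\<not> derivable Fr G (finsert (a, B) \<Gamma>) (finsert (a, C) \<Delta>)" by auto
    then show ?thesis using RightT Imp
      by (intro exI[of _ G] exI[of _ "finsert (a, B) \<Gamma>"] exI[of _ "finsert (a, C) \<Delta>"]) auto
  next
    case (Wand B C)
    with m have m': "finsert (a, Wand B C) \<Delta> = \<Delta>" by simp
    from derivable.WandR[of "b 0" "b 1" G \<Gamma> a B C \<Delta> Fr, unfolded m',
        OF b01 b(2) b(2) b(3) b(3)] nd
    have "\<not> derivable Fr (finsert (Tri (b 0) a (b 1)) G)
      (finsert (b 0, B) \<Gamma>) (finsert (b 1, C) \<Delta>)" by blast
    then show ?thesis using RightT Wand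
      by (intro exI[of _ "finsert (Tri (b 0) a (b 1)) G"]
          exI[of _ "finsert (b 0, B) \<Gamma>"] exI[of _ "finsert (b 1, C) \<Delta>"]) auto
  qed (use nd RightT in auto)
next
  case (StarT x y w A B)
  with act obtain z where m: "finsert (w, Star A B) \<Delta> = \<Delta>"
    and z: "Tri x y z |\<in>| G" "eq_entails G z w"
    by (auto simp: finsert_absorb eq_entails_iff_label_eq)
  from derivable.StarR[OF z, of Fr \<Gamma> A B \<Delta>] m nd
  consider "\<not> derivable Fr G \<Gamma> (finsert (x, A) \<Delta>)" | "\<not> derivable Fr G \<Gamma> (finsert (y, B) \<Delta>)"
    by auto
  then show ?thesis
  proof cases
    case 1
    then show ?thesis using StarT
      by (intro exI[of _ G] exI[of _ \<Gamma>] exI[of _ "finsert (x, A) \<Delta>"]) auto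
  next
    case 2
    then show ?thesis using StarT
      by (intro exI[of _ G] exI[of _ \<Gamma>] exI[of _ "finsert (y, B) \<Delta>"]) auto
  qed
next
  case (WandT x z y A B)
  with act obtain w where m: "finsert (z, Wand A B) \<Gamma> = \<Gamma>"
    "finsert (z, Wand A B) (finsert (y, B) \<Gamma>) = finsert (y, B) \<Gamma>"
    and w: "Tri x w y |\<in>| G" "eq_entails G z w"
    by (auto simp: finsert_absorb eq_entails_iff_label_eq)
  from derivable.WandL[OF w, of Fr A B \<Gamma> \<Delta>] m nd
  consider "\<not> derivable Fr G \<Gamma> (finsert (x, A) \<Delta>)" | "\<not> derivable Fr G (finsert (y, B) \<Gamma>) \<Delta>"
    by auto
  then show ?thesis
  proof cases
    case 1
    then show ?thesis using WandT
      by (intro exI[of _ G] exI[of _ \<Gamma>] exI[of _ "finsert (x, A) \<Delta>"]) auto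
  next
    case 2
    then show ?thesis using WandT
      by (intro exI[of _ G] exI[of _ "finsert (y, B) \<Gamma>"] exI[of _ \<Delta>]) auto
  qed
next
  case (EMT a b)
  from derivable.EM[of Fr a b G \<Gamma> \<Delta>] nd
  consider "\<not> derivable Fr (finsert (Eq a b) G) \<Gamma> \<Delta>" | "\<not> derivable Fr (finsert (Neq a b) G) \<Gamma> \<Delta>"
    by auto
  then show ?thesis
  proof cases
    case 1
    then show ?thesis using EMT
      by (intro exI[of _ "finsert (Eq a b) G"] exI[of _ \<Gamma>] exI[of _ \<Delta>]) auto
  next
    case 2
    then show ?thesis using EMT
      by (intro exI[of _ "finsert (Neq a b) G"] exI[of _ \<Gamma>] exI[of _ \<Delta>]) auto
  qed
next
  case (FrameT ax xs)
  obtain b :: "nat \<Rightarrow> label"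
    where b: "inj b" "\<And>j. b j \<noteq> Eps" "\<And>j. b j \<notin> seq_labels G \<Gamma> \<Delta>"
    using fresh_labels by blast
  let ?\<theta> = "(!) xs"
  let ?G = "G |\<union>| fset_of_list (map (map_atom (inst Eps ?\<theta> b)) (ax_cons ax))"
  from act FrameT have Fr: "ax \<in> Fr" by simp
  with ax have wf: "is_frame_axiom ax" by simp
  have "\<forall>S\<in>set (ax_ants ax). map_atom (inst Eps ?\<theta> b) S |\<in>| G"
  proof
    fix S assume S: "S \<in> set (ax_ants ax)"
    with wf have "set_atom S \<subseteq> univ_terms (ax_m ax)"
      by (auto simp: is_frame_axiom_def intro!: admissible_ant_terms)
    from map_atom_inst_cong[OF this refl, of Eps ?\<theta> b ?\<theta>] S act FrameT
    show "map_atom (inst Eps ?\<theta> b) S |\<in>| G" by simp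
  qed
  moreover have "\<forall>(s, t)\<in>set (ax_eqs ax). eq_entails G (inst Eps ?\<theta> b s) (inst Eps ?\<theta> b t)"
  proof clarify
    fix s t assume st: "(s, t) \<in> set (ax_eqs ax)"
    with wf have "s \<in> univ_terms (ax_m ax)" "t \<in> univ_terms (ax_m ax)"
      by (auto simp: is_frame_axiom_def)
    then have "inst Eps ?\<theta> b s = inst Eps ?\<theta> ?\<theta> s" "inst Eps ?\<theta> b t = inst Eps ?\<theta> ?\<theta> t"
      by (metis inst_cong)+
    with st act FrameT show "eq_entails G (inst Eps ?\<theta> b s) (inst Eps ?\<theta> b t)"
      by (auto simp: eq_entails_iff_label_eq)
  qed
  ultimately have "\<not> derivable Fr ?G \<Gamma> \<Delta>"
    using derivable.Frame[OF Fr, of ?\<theta> b G \<Gamma> \<Delta>] b nd inj_on_subset[OF b(1) subset_UNIV] by blast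
  then show ?thesis using FrameT
    by (intro exI[of _ ?G] exI[of _ \<Gamma>] exI[of _ \<Delta>]) (auto simp: fset_of_list.rep_eq)
qed

section \<open>The limit of a fair chain\<close>

text \<open>Each task is considered at infinitely many stages. One that is active from some stage on
  is therefore fulfilled at its next turn.\<close>

lemma fair_chain:
  fixes good :: "'s::order \<Rightarrow> bool" and act ful :: "'t::countable \<Rightarrow> 's \<Rightarrow> bool"
  assumes start: "good s0"
    and ext: "\<And>t s. good s \<Longrightarrow> act t s \<Longrightarrow> \<exists>s'\<ge>s. good s' \<and> ful t s'"
  obtains f :: "nat \<Rightarrow> 's" where "f 0 = s0" "mono f" "\<And>n. good (f n)"
    "\<And>t. \<forall>\<^sub>F n in sequentially. act t (f n) \<Longrightarrow> \<exists>n. ful t (f n)"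
proof -
  \<comment> \<open>Only the first component of the pair coded by \<open>n\<close> counts; the
    second makes every task recur.\<close>
  define task :: "nat \<Rightarrow> 't" where "task n = from_nat (fst (prod_decode n))" for n
  \<comment> \<open>The clause for \<open>n = 0\<close> pins the first element, which dependent
    choice alone would leave open.\<close>
  have "\<exists>f. \<forall>n. (good (f n) \<and> (n = 0 \<longrightarrow> f n = s0)) \<and>
    (f n \<le> f (Suc n) \<and> (act (task n) (f n) \<longrightarrow> ful (task n) (f (Suc n))))"
  proof (rule dependent_nat_choice)
    fix s and n :: nat assume "good s \<and> (n = 0 \<longrightarrow> s = s0)"
    then show "\<exists>s'. (good s' \<and> (Suc n = 0 \<longrightarrow> s' = s0)) \<and>
        (s \<le> s' \<and> (act (task n) s \<longrightarrow> ful (task n) s'))"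
      using ext[of s "task n"] by (cases "act (task n) s") auto
  qed (use start in auto)
  then obtain f where "\<forall>n. (good (f n) \<and> (n = 0 \<longrightarrow> f n = s0)) \<and>
    (f n \<le> f (Suc n) \<and> (act (task n) (f n) \<longrightarrow> ful (task n) (f (Suc n))))" ..
  then have f: "\<And>n. good (f n)" "f 0 = s0" "\<And>n. f n \<le> f (Suc n)"
    "\<And>n. act (task n) (f n) \<Longrightarrow> ful (task n) (f (Suc n))"
    by auto
  have "\<exists>n. ful t (f n)" if "\<forall>\<^sub>F n in sequentially. act t (f n)" for t
  proof -
    from that obtain k where k: "\<And>n. n \<ge> k \<Longrightarrow> act t (f n)"
      by (auto simp: eventually_sequentially)
    \<comment> \<open>A turn of \<open>t\<close> that is not earlier than \<open>k\<close>, because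
      a pair code bounds its second component.\<close>
    let ?n = "prod_encode (to_nat t, k)"
    have "task ?n = t" by (simp add: task_def)
    with f(4)[of ?n] k[of ?n] le_prod_encode_2[of k "to_nat t"] show ?thesis by auto
  qed
  moreover have "mono f" using f(3) by (simp add: mono_iff_le_Suc)
  ultimately show ?thesis using f(1,2) that by blast
qed

lemma eventually_in_chain:
  fixes X :: "nat \<Rightarrow> 'a fset"
  assumes "mono X" "x \<in> (\<Union>n. fset (X n))"
  shows "\<forall>\<^sub>F n in sequentially. x |\<in>| X n"
proof -
  from assms(2) obtain k where "x |\<in>| X k" by auto
  with monoD[OF assms(1)] have "x |\<in>| X n" if "n \<ge> k" for n using that by blast
  then show ?thesis by (auto simp: eventually_sequentially)
qed

text \<open>Compactness by induction on the closure: each step uses one equation, in either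
  direction, and this equation is present from some stage on.\<close>

lemma eventually_label_eq_chain:
  assumes "mono X" "label_eq (\<Union>n. fset (X n)) a b"
  shows "\<forall>\<^sub>F n in sequentially. label_eq (fset (X n)) a b"
  using assms(2) unfolding label_eq_def
proof (induction rule: equivclp_induct)
  case base
  then show ?case by simp
next
  case (step b c)
  from step(2) have "\<forall>\<^sub>F n in sequentially. Eq b c |\<in>| X n \<or> Eq c b |\<in>| X n"
    using eventually_in_chain[OF assms(1), of "Eq b c"] eventually_in_chain[OF assms(1), of "Eq c b"]
    by (fastforce elim: eventually_mono)
  with step(3) show ?case
    by eventually_elim (meson equivclp_into_equivclp)
qed

lemma eventually_active_chain:
  assumes "mono G" "mono \<Gamma>" "mono \<Delta>"
    and "active Fr t (\<Union>n. fset (G n)) (\<Union>n. fset (\<Gamma> n)) (\<Union>n. fset (\<Delta> n))"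
  shows "\<forall>\<^sub>F n in sequentially. active Fr t (fset (G n)) (fset (\<Gamma> n)) (fset (\<Delta> n))"
proof (cases t)
  case (LeftT a A)
  with assms eventually_in_chain[OF assms(2)] show ?thesis by auto
next
  case (RightT a A)
  with assms eventually_in_chain[OF assms(3)] show ?thesis by auto
next
  case (StarT x y w A B)
  with assms(4) obtain z where "(w, Star A B) \<in> (\<Union>n. fset (\<Delta> n))"
    "Tri x y z \<in> (\<Union>n. fset (G n))" "label_eq (\<Union>n. fset (G n)) z w" by auto
  from eventually_in_chain[OF assms(3) this(1)] eventually_in_chain[OF assms(1) this(2)]
    eventually_label_eq_chain[OF assms(1) this(3)]
  show ?thesis by eventually_elim (use StarT in auto)
next
  case (WandT x z y A B)
  with assms(4) obtain w where "(z, Wand A B) \<in> (\<Union>n. fset (\<Gamma> n))"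
    "Tri x w y \<in> (\<Union>n. fset (G n))" "label_eq (\<Union>n. fset (G n)) z w" by auto
  from eventually_in_chain[OF assms(2) this(1)] eventually_in_chain[OF assms(1) this(2)]
    eventually_label_eq_chain[OF assms(1) this(3)]
  show ?thesis by eventually_elim (use WandT in auto)
next
  case (EMT a b)
  then show ?thesis by simp
next
  case (FrameT ax xs)
  let ?i = "inst Eps ((!) xs) ((!) xs)"
  have "\<forall>\<^sub>F n in sequentially. \<forall>S\<in>set (ax_ants ax). map_atom ?i S |\<in>| G n"
    using assms(4) FrameT
    by (auto intro!: eventually_ball_finite eventually_in_chain[OF assms(1)])
  moreover have "\<forall>\<^sub>F n in sequentially. \<forall>p\<in>set (ax_eqs ax).
      label_eq (fset (G n)) (?i (fst p)) (?i (snd p))"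
    using assms(4) FrameT
    by (auto intro!: eventually_ball_finite eventually_label_eq_chain[OF assms(1)])
  ultimately show ?thesis
    by eventually_elim (use assms(4) FrameT in auto)
qed

section \<open>The countermodel of a Hintikka set\<close>

text \<open>The last three conditions on the sets state that the zero-premise rules depending on
  equations do not apply. The map \<open>W\<close> represents the quotient of the labels by
  \<open>label_eq\<close> inside \<open>'h\<close>: its kernel is exactly that equivalence.\<close>

locale hintikka =
  fixes Fr :: "frame_axiom set"
    and G :: "label atom set" and \<Gamma> \<Delta> :: "'v lfm set"
    and W :: "label \<Rightarrow> 'h"
  assumes fulfilled: "active Fr t G \<Gamma> \<Delta> \<Longrightarrow> fulfilled t G \<Gamma> \<Delta>"
    and Id: "(a, Var p) \<in> \<Gamma> \<Longrightarrow> (b, Var p) \<in> \<Delta> \<Longrightarrow> \<not> label_eq G a b"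
    and TopStarR: "(a, TopStar) \<in> \<Delta> \<Longrightarrow> \<not> label_eq G a Eps"
    and NEq: "Neq a b \<in> G \<Longrightarrow> \<not> label_eq G a b"
    and W_eq_iff: "W a = W b \<longleftrightarrow> label_eq G a b"
begin

text \<open>Worlds are related as soon as some of their representatives form an atom of
  \<open>G\<close>; other representatives need not. This is why \<open>StarT\<close> and
  \<open>WandT\<close> match labels only up to \<open>label_eq\<close>.\<close>

definition canonical :: "('h, 'v) model" where
  "canonical = \<lparr>worlds = range W, rel = {(W a, W b, W c) | a b c. Tri a b c \<in> G},
     unit = W Eps, val = \<lambda>p. {W a | a. (a, Var p) \<in> \<Gamma>}\<rparr>"

lemma canonical_simps [simp]:
  "worlds canonical = range W"
  "rel canonical = {(W a, W b, W c) | a b c. Tri a b c \<in> G}"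
  "unit canonical = W Eps"
  "val canonical p = {W a | a. (a, Var p) \<in> \<Gamma>}"
  by (simp_all add: canonical_def)

lemma is_model_canonical: "is_model canonical"
  by (auto simp: is_model_def is_frame_def)

lemma Eq_imp_W_eq: "Eq a b \<in> G \<Longrightarrow> W a = W b"
  unfolding W_eq_iff label_eq_def by (rule r_into_equivclp)

text \<open>\<open>EM\<close> decides every pair of labels, and the equation would identify the two
  worlds.\<close>

lemma W_neq_imp_Neq: "W a \<noteq> W b \<Longrightarrow> Neq a b \<in> G"
  using fulfilled[of "EMT a b"] Eq_imp_W_eq by auto

text \<open>Both sides are proved together because implication and wand move their left argument to
  the other side.\<close>

lemma truth:
  "((a, A) \<in> \<Gamma> \<longrightarrow> forces canonical (W a) A) \<and> ((a, A) \<in> \<Delta> \<longrightarrow> \<not> forces canonical (W a) A)"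
proof (induction A arbitrary: a)
  case (Var p)
  have "W b \<noteq> W a" if "(b, Var p) \<in> \<Gamma>" "(a, Var p) \<in> \<Delta>" for b
    using Id[OF that] by (simp add: W_eq_iff)
  then show ?case by auto metis
next
  case Top
  then show ?case using fulfilled[of "RightT a Top"] by auto
next
  case Bot
  then show ?case using fulfilled[of "LeftT a Bot"] by auto
next
  case TopStar
  then show ?case using fulfilled[of "LeftT a TopStar"] TopStarR Eq_imp_W_eq W_eq_iff by auto
next
  case (And A B)
  then show ?case
    using fulfilled[of "LeftT a (And A B)"] fulfilled[of "RightT a (And A B)"] by auto
next
  case (Imp A B)
  then show ?case
    using fulfilled[of "LeftT a (Imp A B)"] fulfilled[of "RightT a (Imp A B)"] by auto
next
  case (Star A B)
  have "forces canonical (W a) (Star A B)" if "(a, Star A B) \<in> \<Gamma>"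
    using that fulfilled[of "LeftT a (Star A B)"] Star.IH by fastforce
  moreover have False if "(a, Star A B) \<in> \<Delta>" "forces canonical (W a) (Star A B)"
  proof -
    \<comment> \<open>The atom found in \<open>G\<close> ends in some representative
      \<open>z\<close> of the world of \<open>a\<close>, not necessarily in \<open>a\<close>
      itself.\<close>
    from that(2) obtain x y z where xyz: "Tri x y z \<in> G" "W z = W a"
      "forces canonical (W x) A" "forces canonical (W y) B"
      by auto
    with that(1) have "(x, A) \<in> \<Delta> \<or> (y, B) \<in> \<Delta>"
      using fulfilled[of "StarT x y a A B"] W_eq_iff by auto
    with xyz Star.IH show False by blast
  qed
  ultimately show ?case by blast
next
  case (Wand A B)
  have "\<not> forces canonical (W a) (Wand A B)" if "(a, Wand A B) \<in> \<Delta>"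
    using that fulfilled[of "RightT a (Wand A B)"] Wand.IH by fastforce
  moreover have "forces canonical (W a) (Wand A B)" if "(a, Wand A B) \<in> \<Gamma>"
  proof -
    have "forces canonical (W y) B"
      if "Tri x w y \<in> G" "W a = W w" "forces canonical (W x) A" for x w y
    proof -
      from that \<open>(a, Wand A B) \<in> \<Gamma>\<close> have "(x, A) \<in> \<Delta> \<or> (y, B) \<in> \<Gamma>"
        using fulfilled[of "WandT x a y A B"] W_eq_iff by auto
      with that Wand.IH show ?thesis by blast
    qed
    then show ?thesis by auto
  qed
  ultimately show ?case by blast
qed

text \<open>Starting from arbitrary preimages, each ternary atom overwrites the choice at its three
  variables with the labels that witness it. Linearity protects the atoms treated before.
  \<open>AEps\<close> must be absent from ternary atoms since its label cannot be rechosen; in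
  disequalities it is harmless, as any representatives work there.\<close>

lemma linear_representatives:
  assumes "\<forall>S\<in>set L. admissible_ant m S"
    and "distinct (filter (\<lambda>t. t \<noteq> AEps) (concat (map atom_terms L)))"
    and "\<forall>i<m. x i \<in> range W"
    and "\<forall>S\<in>set L. atom_holds canonical (map_atom (inst (W Eps) x x) S)"
  shows "\<exists>\<theta>. (\<forall>i<m. W (\<theta> i) = x i) \<and> (\<forall>S\<in>set L. map_atom (inst Eps \<theta> \<theta>) S \<in> G)"
  using assms
proof (induction L)
  case Nil
  then have "\<forall>i. \<exists>a. i < m \<longrightarrow> W a = x i" by (metis rangeE)
  from choice[OF this] show ?case by simp
next
  case (Cons S L)
  then obtain \<theta> where \<theta>: "\<forall>i<m. W (\<theta> i) = x i" "\<forall>S\<in>set L. map_atom (inst Eps \<theta> \<theta>) S \<in> G"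
    by auto
  from Cons.prems have adm: "admissible_ant m S"
    and holds: "atom_holds canonical (map_atom (inst (W Eps) x x) S)" by auto
  have rep: "W (inst Eps \<theta> \<theta> s) = inst (W Eps) x x s" if "s \<in> univ_terms m" for s
    using that \<theta>(1) by (auto simp: univ_terms_def)
  show ?case
  proof (cases S)
    case (Tri s t u)
    with adm obtain i j k where ijk: "s = AX i" "t = AX j" "u = AX k" "i < m" "j < m" "k < m"
      by (auto simp: admissible_ant_def univ_terms_def)
    from Cons.prems(2) have dist: "i \<noteq> j" "i \<noteq> k" "j \<noteq> k"
      and new: "\<forall>S\<in>set L. \<forall>v\<in>{AX i, AX j, AX k}. v \<notin> set (atom_terms S)"
      by (auto simp: Tri ijk)
    from holds obtain a b c where abc: "Tri a b c \<in> G" "W a = x i" "W b = x j" "W c = x k"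
      by (auto simp: Tri ijk)
    \<comment> \<open>By \<open>dist\<close> the three updates do not overwrite each other, and by
      \<open>new\<close> no atom of \<open>L\<close> sees them.\<close>
    define \<theta>' where "\<theta>' = \<theta>(i := a, j := b, k := c)"
    have terms: "set (atom_terms S') = set_atom S'" for S' :: "axterm atom" by (cases S') auto
    have "map_atom (inst Eps \<theta>' \<theta>') S' = map_atom (inst Eps \<theta> \<theta>) S'" if "S' \<in> set L" for S'
    proof (rule atom.map_cong0)
      fix v assume v: "v \<in> set_atom S'"
      with that Cons.prems(1) have "v \<in> univ_terms m"
        using admissible_ant_terms[of m S'] by auto
      with v new that show "inst Eps \<theta>' \<theta>' v = inst Eps \<theta> \<theta> v"
        by (auto simp: univ_terms_def terms \<theta>'_def)
    qed
    with \<theta>(2) have "\<forall>S'\<in>set L. map_atom (inst Eps \<theta>' \<theta>') S' \<in> G" by simp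
    moreover have "map_atom (inst Eps \<theta>' \<theta>') S \<in> G"
      using abc(1) dist by (simp add: Tri ijk \<theta>'_def)
    moreover have "\<forall>i<m. W (\<theta>' i) = x i"
      using \<theta>(1) abc by (simp add: \<theta>'_def)
    ultimately show ?thesis by auto
  next
    case (Neq s t)
    with adm have "s \<in> univ_terms m" "t \<in> univ_terms m" by (auto simp: admissible_ant_def)
    with holds have "W (inst Eps \<theta> \<theta> s) \<noteq> W (inst Eps \<theta> \<theta> t)" by (simp add: rep Neq)
    with \<theta> W_neq_imp_Neq show ?thesis by (intro exI[of _ \<theta>]) (auto simp: Neq)
  next
    case (Eq s t)
    with adm show ?thesis by (simp add: admissible_ant_def)
  qed
qed

lemma atom_holds_canonical:
  "T \<in> G \<Longrightarrow> atom_holds canonical (map_atom W T)"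
  using Eq_imp_W_eq NEq by (cases T) (auto simp flip: W_eq_iff)

text \<open>With suitable representatives the antecedent atoms lie in \<open>G\<close> and the
  equations hold up to \<open>label_eq\<close>, so the task of this axiom is active and its
  fulfilment supplies the consequent.\<close>

lemma satisfies_canonical:
  assumes "ax \<in> Fr" and wf: "is_frame_axiom ax"
  shows "satisfies canonical ax"
  unfolding satisfies_def
proof (intro allI impI)
  fix x
  assume x: "\<forall>i<ax_m ax. x i \<in> worlds canonical"
    and eqs: "\<forall>(s, t)\<in>set (ax_eqs ax).
      inst (unit canonical) x x s = inst (unit canonical) x x t"
    and ants: "\<forall>S\<in>set (ax_ants ax). atom_holds canonical (map_atom (inst (unit canonical) x x) S)"
  from wf have wf': "\<forall>S\<in>set (ax_ants ax). admissible_ant (ax_m ax) S"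
    "distinct (filter (\<lambda>t. t \<noteq> AEps) (concat (map atom_terms (ax_ants ax))))"
    by (auto simp: is_frame_axiom_def)
  from linear_representatives[OF wf'] x ants
  obtain \<theta> where \<theta>: "\<forall>i<ax_m ax. W (\<theta> i) = x i"
    "\<forall>S\<in>set (ax_ants ax). map_atom (inst Eps \<theta> \<theta>) S \<in> G"
    by (metis canonical_simps(1,3))
  \<comment> \<open>A task holds finitely many labels; entries beyond \<open>ax_m ax\<close> are
    never read, as axiom variables stay below that bound.\<close>
  define xs where "xs = map \<theta> [0..<ax_m ax]"
  then have xs: "\<And>i. i < ax_m ax \<Longrightarrow> xs ! i = \<theta> i" by simp
  have "map_atom (inst Eps ((!) xs) ((!) xs)) S \<in> G" if "S \<in> set (ax_ants ax)" for S
  proof -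
    from that wf'(1) have "admissible_ant (ax_m ax) S" by blast
    from map_atom_inst_cong[OF admissible_ant_terms[OF this] xs]
    have "map_atom (inst Eps ((!) xs) ((!) xs)) S = map_atom (inst Eps \<theta> \<theta>) S" .
    with \<theta>(2) that show ?thesis by simp
  qed
  moreover have "label_eq G (inst Eps ((!) xs) ((!) xs) s) (inst Eps ((!) xs) ((!) xs) t)"
    if st: "(s, t) \<in> set (ax_eqs ax)" for s t
  proof -
    have "W (inst Eps ((!) xs) ((!) xs) v) = inst (W Eps) x x v" if "v \<in> univ_terms (ax_m ax)" for v
      using that \<theta>(1) xs by (auto simp: univ_terms_def)
    moreover have "s \<in> univ_terms (ax_m ax)" "t \<in> univ_terms (ax_m ax)"
      using wf st by (auto simp: is_frame_axiom_def)
    ultimately show ?thesis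
      using eqs st by (auto simp flip: W_eq_iff)
  qed
  ultimately obtain b
    where b: "\<forall>T\<in>set (ax_cons ax). map_atom (inst Eps ((!) xs) b) T \<in> G"
    using fulfilled[of "FrameT ax xs"] assms(1) by auto
  \<comment> \<open>The existential witnesses are the worlds of the labels that the structural rule
    introduced.\<close>
  have "atom_holds canonical (map_atom (inst (unit canonical) x (W \<circ> b)) T)"
    if T: "T \<in> set (ax_cons ax)" for T
  proof -
    have "map_atom W (map_atom (inst Eps ((!) xs) b) T) = map_atom (inst (W Eps) x (W \<circ> b)) T"
      unfolding atom.map_comp
    proof (rule atom.map_cong0)
      fix v assume "v \<in> set_atom T"
      with wf T have "v \<in> univ_terms (ax_m ax) \<union> ex_terms (ax_n ax)"
        by (auto simp: is_frame_axiom_def)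
      then show "(W \<circ> inst Eps ((!) xs) b) v = inst (W Eps) x (W \<circ> b) v"
        using \<theta>(1) xs by (auto simp: univ_terms_def ex_terms_def)
    qed
    with atom_holds_canonical b T show ?thesis by (metis canonical_simps(3))
  qed
  then show "\<exists>y. (\<forall>j<ax_n ax. y j \<in> worlds canonical) \<and>
      (\<forall>T\<in>set (ax_cons ax). atom_holds canonical (map_atom (inst (unit canonical) x y) T))"
    by (intro exI[of _ "W \<circ> b"]) auto
qed

end

section \<open>From an underivable sequent to a countermodel\<close>

lemma label_eq_quotient:
  assumes "infinite (UNIV :: 'h set)"
  obtains W :: "label \<Rightarrow> 'h" where "\<And>a b. W a = W b \<longleftrightarrow> label_eq G a b"
proof -
  from infinite_countable_subset[OF assms] obtain g :: "nat \<Rightarrow> 'h" where "inj g" by auto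
  have refl: "label_eq G a a" for a by (simp add: label_eq_def)
  have eq: "(label_eq G a = label_eq G b) \<longleftrightarrow> label_eq G a b" for a b
  proof
    assume "label_eq G a = label_eq G b"
    with refl[of b] show "label_eq G a b" by simp
  next
    assume "label_eq G a b"
    then show "label_eq G a = label_eq G b"
      unfolding label_eq_def by (intro ext iffI) (meson equivclp_sym equivclp_trans)+
  qed
  \<comment> \<open>The choice depends on \<open>a\<close> only through its class, so equivalent
    labels get the same representative; coding it by a number then embeds the quotient into
    \<open>'h\<close>.\<close>
  let ?r = "\<lambda>a. SOME c. label_eq G a c"
  have r: "label_eq G a (?r a)" for a
    by (rule someI[of _ a]) (rule refl)
  have "?r a = ?r b \<longleftrightarrow> label_eq G a b" for a b
    by (metis r eq)
  with \<open>inj g\<close> that[of "\<lambda>a. g (to_nat (?r a))"] show ?thesis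
    by (simp add: inj_eq)
qed

text \<open>The chain lives in triples under the componentwise order, and its union is the Hintikka
  set. Were a zero-premise rule applicable to the union, the finitely many facts it uses would occur
  together at some stage and make that stage derivable.\<close>

lemma underivable_hintikka:
  fixes \<Gamma>0 \<Delta>0 :: "'v::countable lfm fset"
  assumes ax: "\<forall>ax\<in>Fr. is_frame_axiom ax"
    and nd: "\<not> derivable Fr G0 \<Gamma>0 \<Delta>0"
    and inf: "infinite (UNIV :: 'h set)"
  obtains G \<Gamma> \<Delta> and W :: "label \<Rightarrow> 'h"
  where "hintikka Fr G \<Gamma> \<Delta> W" "fset G0 \<subseteq> G" "fset \<Gamma>0 \<subseteq> \<Gamma>" "fset \<Delta>0 \<subseteq> \<Delta>"
proof -
  obtain f :: "nat \<Rightarrow> label atom fset \<times> 'v lfm fset \<times> 'v lfm fset"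
    where f: "f 0 = (G0, \<Gamma>0, \<Delta>0)" "mono f"
      "\<And>n. case f n of (G, \<Gamma>, \<Delta>) \<Rightarrow> \<not> derivable Fr G \<Gamma> \<Delta>"
      "\<And>t. \<forall>\<^sub>F n in sequentially. (case f n of (G, \<Gamma>, \<Delta>) \<Rightarrow>
          active Fr t (fset G) (fset \<Gamma>) (fset \<Delta>)) \<Longrightarrow>
        \<exists>n. case f n of (G, \<Gamma>, \<Delta>) \<Rightarrow> fulfilled t (fset G) (fset \<Gamma>) (fset \<Delta>)"
  proof (rule fair_chain[of "\<lambda>(G, \<Gamma>, \<Delta>). \<not> derivable Fr G \<Gamma> \<Delta>" "(G0, \<Gamma>0, \<Delta>0)"
        "\<lambda>t (G, \<Gamma>, \<Delta>). active Fr t (fset G) (fset \<Gamma>) (fset \<Delta>)"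
        "\<lambda>t (G, \<Gamma>, \<Delta>). fulfilled t (fset G) (fset \<Gamma>) (fset \<Delta>)"])
    fix t and s :: "label atom fset \<times> 'v lfm fset \<times> 'v lfm fset"
    assume "case s of (G, \<Gamma>, \<Delta>) \<Rightarrow> \<not> derivable Fr G \<Gamma> \<Delta>"
      "case s of (G, \<Gamma>, \<Delta>) \<Rightarrow> active Fr t (fset G) (fset \<Gamma>) (fset \<Delta>)"
    then show "\<exists>s'\<ge>s. (case s' of (G, \<Gamma>, \<Delta>) \<Rightarrow> \<not> derivable Fr G \<Gamma> \<Delta>) \<and>
        (case s' of (G, \<Gamma>, \<Delta>) \<Rightarrow> fulfilled t (fset G) (fset \<Gamma>) (fset \<Delta>))"
      using underivable_fulfil[OF ax] by (cases s) fastforce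
  qed (use nd in auto)
  define G where "G n = fst (f n)" for n
  define \<Gamma> where "\<Gamma> n = fst (snd (f n))" for n
  define \<Delta> where "\<Delta> n = snd (snd (f n))" for n
  have fn: "f n = (G n, \<Gamma> n, \<Delta> n)" for n by (simp add: G_def \<Gamma>_def \<Delta>_def)
  have mono: "mono G" "mono \<Gamma>" "mono \<Delta>"
    using f(2) by (auto simp: mono_def fn)
  define GS \<Gamma>S \<Delta>S
    where S_defs: "GS = (\<Union>n. fset (G n))" "\<Gamma>S = (\<Union>n. fset (\<Gamma> n))" "\<Delta>S = (\<Union>n. fset (\<Delta> n))"
  have und: "\<not> derivable Fr (G n) (\<Gamma> n) (\<Delta> n)" for n using f(3)[of n] by (simp add: fn)
  obtain W :: "label \<Rightarrow> 'h" where W: "\<And>a b. W a = W b \<longleftrightarrow> label_eq GS a b"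
    using label_eq_quotient[OF inf] by metis
  note ev = eventually_in_chain[OF mono(1), folded S_defs]
    eventually_in_chain[OF mono(2), folded S_defs]
    eventually_in_chain[OF mono(3), folded S_defs]
    eventually_label_eq_chain[OF mono(1), folded S_defs eq_entails_iff_label_eq]
  have "hintikka Fr GS \<Gamma>S \<Delta>S W"
  proof
    fix t :: "'v task" assume "active Fr t GS \<Gamma>S \<Delta>S"
    then have "\<exists>n. fulfilled t (fset (G n)) (fset (\<Gamma> n)) (fset (\<Delta> n))"
      using f(4)[of t] eventually_active_chain[OF mono] by (simp add: fn S_defs)
    then show "fulfilled t GS \<Gamma>S \<Delta>S"
      \<comment> \<open>Fulfilment at a single stage carries over to the union.\<close>
      by (auto simp: S_defs elim!: fulfilled_mono)
  next
    fix a b p assume "(a, Var p) \<in> \<Gamma>S" "(b, Var p) \<in> \<Delta>S"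
    show "\<not> label_eq GS a b"
    proof
      assume "label_eq GS a b"
      from ev(2)[OF \<open>(a, Var p) \<in> \<Gamma>S\<close>] ev(3)[OF \<open>(b, Var p) \<in> \<Delta>S\<close>] ev(4)[OF this]
      have "\<forall>\<^sub>F n in sequentially. derivable Fr (G n) (\<Gamma> n) (\<Delta> n)"
        by eventually_elim (metis derivable.Id finsert_absorb)
      with und show False by simp
    qed
  next
    fix a assume "(a, TopStar) \<in> \<Delta>S"
    show "\<not> label_eq GS a Eps"
    proof
      assume "label_eq GS a Eps"
      from ev(3)[OF \<open>(a, TopStar) \<in> \<Delta>S\<close>] ev(4)[OF this]
      have "\<forall>\<^sub>F n in sequentially. derivable Fr (G n) (\<Gamma> n) (\<Delta> n)"
        by eventually_elim (metis derivable.TopStarR finsert_absorb)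
      with und show False by simp
    qed
  next
    fix a b assume "Neq a b \<in> GS"
    show "\<not> label_eq GS a b"
    proof
      assume "label_eq GS a b"
      from ev(1)[OF \<open>Neq a b \<in> GS\<close>] ev(4)[OF this]
      have "\<forall>\<^sub>F n in sequentially. derivable Fr (G n) (\<Gamma> n) (\<Delta> n)"
        by eventually_elim (rule derivable.NEq)
      with und show False by simp
    qed
  qed (rule W)
  moreover have "fset G0 \<subseteq> GS" "fset \<Gamma>0 \<subseteq> \<Gamma>S" "fset \<Delta>0 \<subseteq> \<Delta>S"
    using f(1) fn[of 0] by (auto simp: S_defs)
  ultimately show ?thesis using that by blast
qed

theorem theorem3p11:
  fixes Fr :: "frame_axiom set"
    and F :: "'v::countable fm"
    and w :: label
  assumes "finite Fr"
    and "\<forall>ax\<in>Fr. is_frame_axiom ax"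
    and "infinite (UNIV :: 'h set)"
    and "w \<noteq> Eps"
    and "\<not> derivable Fr {||} {||} {|(w, F)|}"
  shows "\<not> valid_in (models_of Fr :: ('h, 'v) model set) F"
proof -
  \<comment> \<open>Since \<open>(w, F)\<close> stays on the right-hand side, the world of
    \<open>w\<close> will refute \<open>F\<close>.\<close>
  obtain G \<Gamma> \<Delta> and W :: "label \<Rightarrow> 'h"
    where "hintikka Fr G \<Gamma> \<Delta> W" and "fset {|(w, F)|} \<subseteq> \<Delta>"
    by (rule underivable_hintikka[OF assms(2,5,3)])
  then interpret hintikka Fr G \<Gamma> \<Delta> W by blast
  have "canonical \<in> models_of Fr"
    using is_model_canonical satisfies_canonical assms(2) by (simp add: models_of_def)
  moreover have "\<not> forces canonical (W w) F"
    using truth \<open>fset {|(w, F)|} \<subseteq> \<Delta>\<close> by auto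
  moreover have "W w \<in> worlds canonical" by simp
  ultimately show ?thesis
    unfolding valid_in_def by blast
qed

end
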